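(* Let $(X,\delta,\Lambda)$ be a guided dynamical system with $\delta=(\delta_1,\dots,\delta_N)$ and $\Lambda=(\Lambda_1,\dots,\Lambda_N)$. Let $f:X\to\mathbb{R}$ be an upper (respectively lower) semi-continuous function satisfying $$f(x)-\sum_{i=1}^N a_i(x)\,f(\delta_i(x))=0,\qquad x\in X,$$ where the functions $a_i:X\to\mathbb{R}$ satisfy: $a_i(x)\ge 0$ for all $i$ and all $x\in X$; $a_i(x)>0$ for all $i$ and all $x\notin\Lambda_i$; and $\sum_{i=1}^N a_i(x)=1$ for all $x\in X$. If $f$ attains its maximum (respectively minimum) at some point $y_0\in X$, then $f$ attains its maximum (respectively minimum) at every point $x\in\overline{\Lambda\text{-}OS(y_0)}$.
   Context: A guided dynamical system $(X,\delta,\Lambda)$ consists of a metric space $X$, a finite family $\delta=(\delta_1,\dots,\delta_N)$ of continuous maps $\delta_i:X\to X$, and a family $\Lambda=(\Lambda_1,\dots,\Lambda_N)$ of closed subsets of $X$ (guiding sets); it is always assumed that $\bigcap_{i=1}^N\Lambda_i=\emptyset$. A $\Lambda$-proper orbit emanating from $x_1$ is a finite or infinite sequence $(x_1,x_2,\dots)$ such that for every $j\ge 2$ there is an index $i$ with $x_{j-1}\notin\Lambda_i$ and $x_j=\delta_i(x_{j-1})$. The $\Lambda$-orbit set $\Lambda\text{-}OS(x)$ is the set of all $y$ for which there is a finite $\Lambda$-proper orbit $(x,\dots,y)$ (the one-term orbit $(x)$ is allowed, so $x\in\Lambda\text{-}OS(x)$). *)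

theory Defs
  imports "HOL-Analysis.Analysis" "HOL-Library.Extended_Nat"
begin

definition upper_semicontinuous :: "('a::topological_space \<Rightarrow> real) \<Rightarrow> bool" where
  "upper_semicontinuous f \<longleftrightarrow> (\<forall>x c. f x < c \<longrightarrow> (\<forall>\<^sub>F y in nhds x. f y < c))"

definition lower_semicontinuous :: "('a::topological_space \<Rightarrow> real) \<Rightarrow> bool" where
  "lower_semicontinuous f \<longleftrightarrow> (\<forall>x c. c < f x \<longrightarrow> (\<forall>\<^sub>F y in nhds x. c < f y))"

(* The metric space X is the type 'a; the families of maps and of guiding sets are indexed by
   {1..N}, and their values at other indices are irrelevant. *)
definition guided_dynamical_system ::
  "nat \<Rightarrow> (nat \<Rightarrow> 'a::metric_space \<Rightarrow> 'a) \<Rightarrow> (nat \<Rightarrow> 'a set) \<Rightarrow> bool" where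
  "guided_dynamical_system N \<delta> \<Lambda> \<longleftrightarrow>
     (\<forall>i\<in>{1..N}. continuous_on UNIV (\<delta> i)) \<and>
     (\<forall>i\<in>{1..N}. closed (\<Lambda> i)) \<and>
     (\<Inter>i\<in>{1..N}. \<Lambda> i) = {}"

(* The sequence (u 1, u 2, ...) has L terms, where L may be infinite;
   values of u outside these positions are irrelevant. *)
definition proper_orbit ::
  "nat \<Rightarrow> (nat \<Rightarrow> 'a \<Rightarrow> 'a) \<Rightarrow> (nat \<Rightarrow> 'a set) \<Rightarrow> enat \<Rightarrow> (nat \<Rightarrow> 'a) \<Rightarrow> bool" where
  "proper_orbit N \<delta> \<Lambda> L u \<longleftrightarrow>
     1 \<le> L \<and>
     (\<forall>j\<ge>2. enat j \<le> L \<longrightarrow>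
        (\<exists>i\<in>{1..N}. u (j - 1) \<notin> \<Lambda> i \<and> u j = \<delta> i (u (j - 1))))"

definition orbit_set ::
  "nat \<Rightarrow> (nat \<Rightarrow> 'a \<Rightarrow> 'a) \<Rightarrow> (nat \<Rightarrow> 'a set) \<Rightarrow> 'a \<Rightarrow> 'a set" where
  "orbit_set N \<delta> \<Lambda> x =
     {y. \<exists>n u. proper_orbit N \<delta> \<Lambda> (enat n) u \<and> u 1 = x \<and> u n = y}"

end

theory Submission
  imports Defs
begin

text \<open>
  At a maximum point the functional equation writes the maximal value as a convex combination of
  values that do not exceed it, so every value carrying positive weight is maximal too. Hence
  maximality propagates along proper orbits, and upper semicontinuity carries it to the closure.
  The statement about minima is the one about maxima applied to the negated function.
\<close>

text \<open>The deficits \<open>M - g i\<close> are nonnegative and their weighted sum is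
  \<open>M - M = 0\<close>, so each product \<open>w i * (M - g i)\<close> vanishes.\<close>

lemma convex_combination_eq_bound:
  fixes w g :: "'i \<Rightarrow> real"
  assumes "finite I"
    and nonneg: "\<And>i. i \<in> I \<Longrightarrow> 0 \<le> w i"
    and weights: "(\<Sum>i\<in>I. w i) = 1"
    and bound: "\<And>i. i \<in> I \<Longrightarrow> g i \<le> M"
    and mean: "(\<Sum>i\<in>I. w i * g i) = M"
    and "i \<in> I" "0 < w i"
  shows "g i = M"
proof -
  have "(\<Sum>i\<in>I. w i * (M - g i)) = (\<Sum>i\<in>I. w i) * M - (\<Sum>i\<in>I. w i * g i)"
    by (simp add: right_diff_distrib sum_subtractf sum_distrib_right)
  also have "\<dots> = 0"
    using weights mean by simp
  finally have "w i * (M - g i) = 0"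
    using sum_nonneg_eq_0_iff[OF \<open>finite I\<close>, of "\<lambda>i. w i * (M - g i)"]
      nonneg bound \<open>i \<in> I\<close> by simp
  then show ?thesis
    using \<open>0 < w i\<close> by simp
qed

text \<open>Induction on the number of terms: dropping the last term of a longer proper orbit leaves
  a proper orbit, and the dropped term arises by some \<open>\<delta> i\<close> from a point outside
  \<open>\<Lambda> i\<close>.\<close>

lemma proper_orbit_invariant:
  assumes "proper_orbit N \<delta> \<Lambda> (enat n) u" and "P (u 1)"
    and step: "\<And>i x. i \<in> {1..N} \<Longrightarrow> x \<notin> \<Lambda> i \<Longrightarrow> P x \<Longrightarrow> P (\<delta> i x)"
  shows "P (u n)"
proof -
  \<comment> \<open>Without \<open>1 \<le> n\<close> the value \<open>u 0\<close> would be
    arbitrary; the induction starts at the one-term orbit.\<close>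
  have "1 \<le> n"
    using assms(1) by (simp add: proper_orbit_def one_enat_def)
  then show ?thesis
    using assms(1)
  proof (induction n rule: dec_induct)
    case base
    show ?case by (fact \<open>P (u 1)\<close>)
  next
    case (step n)
    have "proper_orbit N \<delta> \<Lambda> (enat n) u"
      using step.prems step.hyps by (auto simp: proper_orbit_def one_enat_def)
    then have "P (u n)"
      by (rule step.IH)
    \<comment> \<open>The orbit condition at \<open>j = Suc n\<close>, where
      \<open>1 \<le> n\<close> guarantees \<open>2 \<le> j\<close>.\<close>
    moreover obtain i where "i \<in> {1..N}" "u n \<notin> \<Lambda> i" "u (Suc n) = \<delta> i (u n)"
      using step.prems step.hyps by (force simp: proper_orbit_def dest: spec[of _ "Suc n"])
    ultimately show ?case
      using assms(3) by simp
  qed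
qed

text \<open>If \<open>f x < M\<close>, then \<open>f\<close> stays below \<open>M\<close> on a whole
  neighbourhood of \<open>x\<close>, and that neighbourhood meets \<open>S\<close>.\<close>

lemma upper_semicontinuous_closure_ge:
  assumes "upper_semicontinuous f" and "\<And>y. y \<in> S \<Longrightarrow> M \<le> f y" and "x \<in> closure S"
  shows "M \<le> f x"
proof (rule ccontr)
  assume "\<not> M \<le> f x"
  then have "\<forall>\<^sub>F y in nhds x. f y < M"
    using assms(1) by (simp add: upper_semicontinuous_def)
  then obtain U where "open U" "x \<in> U" and U: "\<And>y. y \<in> U \<Longrightarrow> f y < M"
    by (auto simp: eventually_nhds)
  then have "U \<inter> S \<noteq> {}"
    using assms(3) open_Int_closure_eq_empty[of U S] by blast
  then show False
    using U assms(2) by (force simp: not_le[symmetric])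
qed

lemma arg_max_closure_orbit_set:
  fixes f :: "'a::metric_space \<Rightarrow> real"
  assumes mean: "\<And>x. f x = (\<Sum>i=1..N. a i x * f (\<delta> i x))"
    and nonneg: "\<And>i x. i \<in> {1..N} \<Longrightarrow> 0 \<le> a i x"
    and pos: "\<And>i x. i \<in> {1..N} \<Longrightarrow> x \<notin> \<Lambda> i \<Longrightarrow> 0 < a i x"
    and weights: "\<And>x. (\<Sum>i=1..N. a i x) = 1"
    and "upper_semicontinuous f"
    and "is_arg_max f (\<lambda>_. True) y"
    and "x \<in> closure (orbit_set N \<delta> \<Lambda> y)"
  shows "is_arg_max f (\<lambda>_. True) x"
proof -
  have max: "f z \<le> f y" for z
    using assms(6) by (auto simp: is_arg_max_def not_less)
  \<comment> \<open>At \<open>z\<close> the convex combination equals its upper bound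
    \<open>f y\<close>, and \<open>z \<notin> \<Lambda> i\<close> makes the weight
    \<open>a i z\<close> positive.\<close>
  have step: "f (\<delta> i z) = f y" if "i \<in> {1..N}" "z \<notin> \<Lambda> i" "f z = f y" for i z
    by (rule convex_combination_eq_bound[where I = "{1..N}" and w = "\<lambda>i. a i z"
          and g = "\<lambda>i. f (\<delta> i z)" and i = i])
      (use that max nonneg pos weights mean[of z] in auto)
  have "f z = f y" if z: "z \<in> orbit_set N \<delta> \<Lambda> y" for z
  proof -
    obtain n u where u: "proper_orbit N \<delta> \<Lambda> (enat n) u" "u 1 = y" "u n = z"
      using z by (auto simp: orbit_set_def)
    have "f (u n) = f y"
      using u(1) by (rule proper_orbit_invariant) (use u(2) step in auto)
    then show ?thesis
      using u(3) by simp
  qed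
  \<comment> \<open>Only the lower bound has to survive the passage to the closure; the upper bound
    is the maximality of \<open>y\<close>.\<close>
  then have "f y \<le> f x"
    using upper_semicontinuous_closure_ge[OF assms(5) _ assms(7)] by simp
  then show ?thesis
    using max by (auto simp: is_arg_max_def not_less intro: order_trans)
qed

lemma upper_semicontinuous_uminus_iff:
  "upper_semicontinuous (\<lambda>x. - f x) \<longleftrightarrow> lower_semicontinuous f"
proof -
  \<comment> \<open>Negation permutes the reals, so the threshold \<open>c\<close> may be replaced
    by \<open>- c\<close>; cancelling the signs then reverses the inequalities.\<close>
  have "(\<forall>c. P c) \<longleftrightarrow> (\<forall>c. P (- c))" for P :: "real \<Rightarrow> bool"
    by (metis minus_minus)
  from this[of "\<lambda>c. - f x < c \<longrightarrow> (\<forall>\<^sub>F y in nhds x. - f y < c)" for x]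
  show ?thesis
    by (simp only: upper_semicontinuous_def lower_semicontinuous_def neg_less_iff_less)
qed

lemma is_arg_max_uminus_iff:
  fixes f :: "'a \<Rightarrow> real"
  shows "is_arg_max (\<lambda>x. - f x) P x \<longleftrightarrow> is_arg_min f P x"
  by (simp add: is_arg_max_def is_arg_min_def)

theorem lemma2p1p2:
  fixes N :: nat
    and \<delta> :: "nat \<Rightarrow> 'a::metric_space \<Rightarrow> 'a"
    and \<Lambda> :: "nat \<Rightarrow> 'a set"
    and f :: "'a \<Rightarrow> real"
    and a :: "nat \<Rightarrow> 'a \<Rightarrow> real"
    and y\<^sub>0 :: 'a
  assumes "guided_dynamical_system N \<delta> \<Lambda>"
    and "\<And>x. f x - (\<Sum>i=1..N. a i x * f (\<delta> i x)) = 0"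
    and "\<And>i x. i \<in> {1..N} \<Longrightarrow> a i x \<ge> 0"
    and "\<And>i x. i \<in> {1..N} \<Longrightarrow> x \<notin> \<Lambda> i \<Longrightarrow> a i x > 0"
    and "\<And>x. (\<Sum>i=1..N. a i x) = 1"
  shows "(upper_semicontinuous f \<and> is_arg_max f (\<lambda>_. True) y\<^sub>0 \<longrightarrow>
            (\<forall>x \<in> closure (orbit_set N \<delta> \<Lambda> y\<^sub>0). is_arg_max f (\<lambda>_. True) x)) \<and>
         (lower_semicontinuous f \<and> is_arg_min f (\<lambda>_. True) y\<^sub>0 \<longrightarrow>
            (\<forall>x \<in> closure (orbit_set N \<delta> \<Lambda> y\<^sub>0). is_arg_min f (\<lambda>_. True) x))"
proof (intro conjI impI ballI; elim conjE)
  \<comment> \<open>The function \<open>g\<close> is left free because it is instantiated with both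
    \<open>f\<close> and its negation.\<close>
  have arg_max: "is_arg_max g (\<lambda>_. True) x"
    if "\<And>x. g x = (\<Sum>i=1..N. a i x * g (\<delta> i x))" "upper_semicontinuous g"
      "is_arg_max g (\<lambda>_. True) y\<^sub>0" "x \<in> closure (orbit_set N \<delta> \<Lambda> y\<^sub>0)" for g x
    by (rule arg_max_closure_orbit_set[where a = a and \<delta> = \<delta>]) (fact that assms(3-5))+
  have mean: "f x = (\<Sum>i=1..N. a i x * f (\<delta> i x))" for x
    using assms(2)[of x] by simp
  \<comment> \<open>The functional equation is linear and homogeneous in \<open>f\<close>, so the
    negated function satisfies it with the same weights.\<close>
  have neg_mean: "- f x = (\<Sum>i=1..N. a i x * - f (\<delta> i x))" for x
    by (subst mean) (simp add: sum_negf)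
  fix x
  {
    assume "upper_semicontinuous f" "is_arg_max f (\<lambda>_. True) y\<^sub>0"
      and "x \<in> closure (orbit_set N \<delta> \<Lambda> y\<^sub>0)"
    with mean show "is_arg_max f (\<lambda>_. True) x"
      by (rule arg_max)
  next
    assume "lower_semicontinuous f" "is_arg_min f (\<lambda>_. True) y\<^sub>0"
      and "x \<in> closure (orbit_set N \<delta> \<Lambda> y\<^sub>0)"
    then show "is_arg_min f (\<lambda>_. True) x"
      using arg_max[of "\<lambda>x. - f x", OF neg_mean]
      unfolding upper_semicontinuous_uminus_iff is_arg_max_uminus_iff by blast
  }
qed

end
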